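(* Let $K\ge 1$, let $\lambda>0$, and let $c_1,\dots,c_K>0$ and $u_1,\dots,u_K>0$ satisfy $c_k\neq u_k$ for every $k$. Consider a file in a parallel network of $K$ caches, with source update rate $\lambda$, source-to-cache update rates $c_k$ and cache-to-user update rates $u_k$. Then the long-term average freshness of the file at the user is $$F_u = 1-\frac{\prod_{k=1}^K c_k\prod_{k=1}^K u_k}{\prod_{k=1}^K(c_k-u_k)}\left(\sum_{p\in V_p}\frac{(-1)^{S_c(p)}}{\prod_{k=1}^K p_k}\cdot\frac{1}{1+\frac{\sum_{k=1}^K p_k}{\lambda}}\right),$$ where the sum is over the $2^K$ choices $p=(p_1,\dots,p_K)\in V_p=\prod_{k=1}^K\{c_k,u_k\}$ and $S_c(p)=\sum_{k=1}^K \mathbf{1}\{p_k=c_k\}$ is the number of indices $k$ for which $p_k$ is chosen to be $c_k$.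
   Context: Model. A file is updated at a source with i.i.d. exponential inter-update times of rate $\lambda$; $T_s\sim\mathrm{Exp}(\lambda)$ denotes the duration of a typical source update cycle. The source updates the file at cache $k$ with exponential inter-update times of rate $c_k$, and cache $k$ updates the file at the user with exponential inter-update times of rate $u_k$, all independently and without delay or loss. When the source is updated, the versions at the caches and the user become outdated. Within a source cycle, let $W_{c_k}\sim\mathrm{Exp}(c_k)$ be the waiting time until cache $k$ gets the current version and $\bar W_{u_k}\sim\mathrm{Exp}(u_k)$ the subsequent waiting time until cache $k$ updates the user; put $X_k=W_{c_k}+\bar W_{u_k}$. All the variables $T_s,W_{c_k},\bar W_{u_k}$ are independent. The user becomes fresh at the first successful update from any cache and stays fresh until the end of the cycle, so the waiting time in a cycle is $W_u=\min\{T_s,X_1,\dots,X_K\}$ ($W_u=T_s$ meaning that the user is not made fresh in that cycle), and the fresh duration is $T_u=T_s-W_u$. The long-term average freshness at the user (long-run fraction of time the user has the version currently at the source) is $F_u=\mathbb{E}[T_u]/\mathbb{E}[T_s]$. *)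

theory Defs
  imports "HOL-Probability.Probability"
begin

datatype timer = Source | To_Cache nat | To_User nat

text \<open>
  One source update cycle of a parallel network of \<open>K\<close> caches, labelled \<open>1, \<dots>, K\<close>:
  \<open>T\<close> is the length of the cycle, \<open>W k\<close> the time until cache \<open>k\<close> gets the current version,
  and \<open>V k\<close> the further time until cache \<open>k\<close> updates the user.  All \<open>2 * K + 1\<close> variables
  are jointly independent.
\<close>

locale parallel_cache_cycle = prob_space M
  for M :: "'a measure"
    and K :: nat
    and lam :: real
    and c u :: "nat \<Rightarrow> real"
    and T :: "'a \<Rightarrow> real"
    and W V :: "nat \<Rightarrow> 'a \<Rightarrow> real" +
  assumes source_exponential: "distributed M lborel T (exponential_density lam)"
    and to_cache_exponential:
      "\<And>k. k \<in> {1..K} \<Longrightarrow> distributed M lborel (W k) (exponential_density (c k))"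
    and to_user_exponential:
      "\<And>k. k \<in> {1..K} \<Longrightarrow> distributed M lborel (V k) (exponential_density (u k))"
    and timers_independent:
      "indep_vars (\<lambda>_. borel)
         (\<lambda>i. case i of Source \<Rightarrow> T | To_Cache k \<Rightarrow> W k | To_User k \<Rightarrow> V k)
         ({Source} \<union> To_Cache ` {1..K} \<union> To_User ` {1..K})"

text \<open>
  The waiting time includes \<open>T\<close> in the minimum: it equals \<open>T\<close> when no cache reaches the user
  with the current version before the cycle ends.
\<close>

definition user_wait ::
  "nat \<Rightarrow> ('a \<Rightarrow> real) \<Rightarrow> (nat \<Rightarrow> 'a \<Rightarrow> real) \<Rightarrow> (nat \<Rightarrow> 'a \<Rightarrow> real) \<Rightarrow> 'a \<Rightarrow> real" where
  "user_wait K T W V \<omega> = Min (insert (T \<omega>) ((\<lambda>k. W k \<omega> + V k \<omega>) ` {1..K}))"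

definition fresh_duration ::
  "nat \<Rightarrow> ('a \<Rightarrow> real) \<Rightarrow> (nat \<Rightarrow> 'a \<Rightarrow> real) \<Rightarrow> (nat \<Rightarrow> 'a \<Rightarrow> real) \<Rightarrow> 'a \<Rightarrow> real" where
  "fresh_duration K T W V \<omega> = T \<omega> - user_wait K T W V \<omega>"

text \<open>
  The long-run fraction of time the user is fresh, as the ratio of the expected fresh time in a
  cycle to the expected cycle length.
\<close>

definition user_freshness ::
  "'a measure \<Rightarrow> nat \<Rightarrow> ('a \<Rightarrow> real) \<Rightarrow> (nat \<Rightarrow> 'a \<Rightarrow> real) \<Rightarrow> (nat \<Rightarrow> 'a \<Rightarrow> real) \<Rightarrow> real" where
  "user_freshness M K T W V =
     prob_space.expectation M (fresh_duration K T W V) / prob_space.expectation M T"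

definition rate_choices :: "nat \<Rightarrow> (nat \<Rightarrow> real) \<Rightarrow> (nat \<Rightarrow> real) \<Rightarrow> (nat \<Rightarrow> real) set" where
  "rate_choices K c u = (\<Pi>\<^sub>E k\<in>{1..K}. {c k, u k})"

definition num_cache_rates :: "nat \<Rightarrow> (nat \<Rightarrow> real) \<Rightarrow> (nat \<Rightarrow> real) \<Rightarrow> nat" where
  "num_cache_rates K c p = card {k \<in> {1..K}. p k = c k}"

end

theory Submission
  imports Defs
begin

text \<open>
  Since the expected cycle length is \<open>1 / \<lambda>\<close>, the claim amounts to computing the expected waiting
  time, which is the integral of \<open>P(W\<^sub>u > t)\<close> over \<open>t \<ge> 0\<close>.  By independence this tail is
  \<open>exp (- \<lambda> t)\<close> times the product of the hypoexponential tails
  \<open>P(X\<^sub>k > t) = c\<^sub>k u\<^sub>k / (c\<^sub>k - u\<^sub>k) * (exp (- u\<^sub>k t) / u\<^sub>k - exp (- c\<^sub>k t) / c\<^sub>k)\<close>.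
  Expanding the product picks one of the two rates for each cache, giving a signed sum of
  exponentials over \<open>V\<^sub>p\<close> that is integrated term by term.
\<close>

section \<open>Tail integrals and the hypoexponential tail\<close>

text \<open>The positive part of \<open>X \<omega>\<close> is the length of the set of
  \<open>t \<ge> 0\<close> with \<open>t < X \<omega>\<close>, and Tonelli swaps the two integrals.
  No sign condition on \<open>X\<close> arises, because \<open>ennreal\<close> sends negative values
  to 0.\<close>

lemma (in prob_space) nn_integral_eq_nn_integral_tail:
  fixes X :: "'a \<Rightarrow> real"
  assumes [measurable]: "random_variable borel X"
  shows "(\<integral>\<^sup>+\<omega>. ennreal (X \<omega>) \<partial>M) =
    (\<integral>\<^sup>+t. ennreal \<P>(\<omega> in M. t < X \<omega>) * indicator {0..} t \<partial>lborel)"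
proof -
  interpret P: pair_sigma_finite M lborel ..
  have "(\<integral>\<^sup>+\<omega>. ennreal (X \<omega>) \<partial>M) =
    (\<integral>\<^sup>+\<omega>. \<integral>\<^sup>+t. indicator {\<omega>\<in>space M. t < X \<omega>} \<omega> * indicator {0..} t \<partial>lborel \<partial>M)"
  proof (rule nn_integral_cong)
    fix \<omega> assume "\<omega> \<in> space M"
    then have "(\<integral>\<^sup>+t. indicator {\<omega>\<in>space M. t < X \<omega>} \<omega> * indicator {0..} t \<partial>lborel) =
        (\<integral>\<^sup>+t. indicator {0..<X \<omega>} t \<partial>lborel)"
      by (intro nn_integral_cong) (auto split: split_indicator)
    also have "\<dots> = ennreal (X \<omega>)"
      by (cases "0 \<le> X \<omega>") (auto simp: ennreal_neg)
    finally show "ennreal (X \<omega>) =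
      (\<integral>\<^sup>+t. indicator {\<omega>\<in>space M. t < X \<omega>} \<omega> * indicator {0..} t \<partial>lborel)" ..
  qed
  also have "\<dots> = (\<integral>\<^sup>+t. \<integral>\<^sup>+\<omega>. indicator {\<omega>\<in>space M. t < X \<omega>} \<omega> * indicator {0..} t \<partial>M \<partial>lborel)"
    by (rule P.Fubini'[symmetric]) measurable
  also have "\<dots> = (\<integral>\<^sup>+t. ennreal \<P>(\<omega> in M. t < X \<omega>) * indicator {0..} t \<partial>lborel)"
    by (intro nn_integral_cong) (simp add: nn_integral_multc emeasure_eq_measure)
  finally show ?thesis .
qed

lemma tendsto_exp_neg_mult_at_top:
  "0 < a \<Longrightarrow> ((\<lambda>x::real. exp (- a * x)) \<longlongrightarrow> 0) at_top"
  by (intro filterlim_compose[OF exp_at_bot] filterlim_tendsto_neg_mult_at_bot[OF tendsto_const])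
     (auto simp: filterlim_ident)

text \<open>The convolution of the two densities is integrated over \<open>t\<close> to infinity;
  minus the claimed tail is an antiderivative of it.\<close>

lemma (in prob_space) prob_exponential_sum_gt:
  assumes X: "distributed M lborel X (exponential_density a)"
    and Y: "distributed M lborel Y (exponential_density b)"
    and ind: "indep_var borel X borel Y"
    and pos: "0 < a" "0 < b" and ne: "a \<noteq> b" and t: "0 \<le> t"
  shows "\<P>(\<omega> in M. t < X \<omega> + Y \<omega>) = (a * exp (- b * t) - b * exp (- a * t)) / (a - b)"
proof -
  \<comment> \<open>\<open>h\<close> is the density of \<open>X + Y\<close> on the nonnegative
    half-line.\<close>
  define h where "h x = a * b * ((exp (- b * x) - exp (- a * x)) / (a - b))" for x
  have h_nonneg: "0 \<le> h x" if "0 \<le> x" for x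
  proof (cases "a < b")
    case True
    with that have "a * x \<le> b * x"
      by (simp add: mult_right_mono)
    with True pos show ?thesis
      unfolding h_def by (intro mult_nonneg_nonneg divide_nonpos_neg) auto
  next
    case False
    with that have "b * x \<le> a * x"
      by (simp add: mult_right_mono)
    with False ne pos show ?thesis
      unfolding h_def by (intro mult_nonneg_nonneg divide_nonneg_pos) auto
  qed
  \<comment> \<open>Exponential densities vanish at negative arguments, so only
    \<open>0 \<le> y \<le> x\<close> contributes. There the integrand is a constant times
    \<open>exp ((a - b) * y)\<close>, with an elementary antiderivative since
    \<open>a \<noteq> b\<close>.\<close>
  have conv: "(\<integral>\<^sup>+y. ennreal (exponential_density a (x - y)) * ennreal (exponential_density b y) \<partial>lborel) =
      ennreal (h x)" if x: "0 \<le> x" for x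
  proof -
    have "(\<integral>\<^sup>+y. ennreal (exponential_density a (x - y)) * ennreal (exponential_density b y) \<partial>lborel) =
      (\<integral>\<^sup>+y. ennreal (a * b * exp (- a * x) * exp ((a - b) * y)) * indicator {0..x} y \<partial>lborel)"
      using pos by (intro nn_integral_cong)
        (auto simp: exponential_density_def ennreal_mult[symmetric] mult_exp_exp algebra_simps
              split: split_indicator)
    also have "\<dots> = ennreal (a * b * exp (- a * x) / (a - b) * exp ((a - b) * x)
        - a * b * exp (- a * x) / (a - b) * exp ((a - b) * 0))"
    proof (rule nn_integral_FTC_Icc[where F = "\<lambda>y. a * b * exp (- a * x) / (a - b) * exp ((a - b) * y)"])
      show "((\<lambda>y. a * b * exp (- a * x) / (a - b) * exp ((a - b) * y)) has_real_derivative
          a * b * exp (- a * x) * exp ((a - b) * y)) (at y)" for y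
        using ne by (auto intro!: derivative_eq_intros)
    qed (use pos x in auto)
    also have "\<dots> = ennreal (h x)"
      using ne by (simp add: h_def mult_exp_exp algebra_simps diff_divide_distrib)
    finally show ?thesis .
  qed
  have "emeasure M {\<omega>\<in>space M. t < X \<omega> + Y \<omega>} =
      emeasure M ((\<lambda>\<omega>. X \<omega> + Y \<omega>) -` {t<..} \<inter> space M)"
    by (rule arg_cong[where f = "emeasure M"]) auto
  also have "\<dots> = (\<integral>\<^sup>+x. (\<integral>\<^sup>+y. ennreal (exponential_density a (x - y)) *
      ennreal (exponential_density b y) \<partial>lborel) * indicator {t<..} x \<partial>lborel)"
    by (rule distributed_emeasure[OF distributed_convolution[OF ind X Y]]) simp
  \<comment> \<open>Closing the half-line at \<open>t\<close> changes only a null set and gives the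
    domain on which the fundamental theorem is applied. Since \<open>t \<ge> 0\<close>,
    \<open>conv\<close> covers all of it.\<close>
  also have "\<dots> = (\<integral>\<^sup>+x. ennreal (h x) * indicator {t..} x \<partial>lborel)"
    using AE_lborel_singleton[of t]
    by (intro nn_integral_cong_AE) (use t conv in \<open>auto split: split_indicator\<close>)
  also have "\<dots> = ennreal (0 - (- ((a * exp (- b * t) - b * exp (- a * t)) / (a - b))))"
  proof (rule nn_integral_FTC_atLeast)
    have "((\<lambda>x. - ((a * exp (- b * x) - b * exp (- a * x)) / (a - b))) \<longlongrightarrow>
        - ((a * 0 - b * 0) / (a - b))) at_top"
      using pos ne by (intro tendsto_intros tendsto_exp_neg_mult_at_top) auto
    then show "((\<lambda>x. - ((a * exp (- b * x) - b * exp (- a * x)) / (a - b))) \<longlongrightarrow> 0) at_top"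
      by simp
    show "((\<lambda>x. - ((a * exp (- b * x) - b * exp (- a * x)) / (a - b))) has_real_derivative h x) (at x)" for x
    proof -
      have "((\<lambda>x. - ((a * exp (- b * x) - b * exp (- a * x)) / (a - b))) has_real_derivative
          - ((a * (exp (- b * x) * - b) - b * (exp (- a * x) * - a)) / (a - b))) (at x)"
        by (rule derivative_eq_intros refl | simp add: ne)+
      also have "- ((a * (exp (- b * x) * - b) - b * (exp (- a * x) * - a)) / (a - b)) = h x"
        by (simp add: h_def right_diff_distrib diff_divide_distrib mult_ac)
      finally show ?thesis .
    qed
  qed (use t h_nonneg in \<open>auto simp: h_def\<close>)
  finally have "emeasure M {\<omega>\<in>space M. t < X \<omega> + Y \<omega>} =
      ennreal ((a * exp (- b * t) - b * exp (- a * t)) / (a - b))"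
    by simp
  \<comment> \<open>\<open>ennreal\<close> truncates at 0, so equality of the real numbers requires
    the right side to be nonnegative. Numerator and denominator have the same sign, as comparing
    \<open>a\<close> with \<open>b\<close> shows.\<close>
  moreover have "0 \<le> (a * exp (- b * t) - b * exp (- a * t)) / (a - b)"
  proof (cases "a < b")
    case True
    with t pos have "a * exp (- b * t) \<le> b * exp (- a * t)"
      by (intro mult_mono) (auto simp: mult_right_mono)
    with True show ?thesis
      by (intro divide_nonpos_neg) auto
  next
    case False
    with t pos have "b * exp (- a * t) \<le> a * exp (- b * t)"
      by (intro mult_mono) (auto simp: mult_right_mono)
    with False ne show ?thesis
      by (intro divide_nonneg_pos) auto
  qed
  ultimately show ?thesis
    by (simp add: emeasure_eq_measure)
qed


lemma (in prob_space) AE_exponential_nonneg: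
  assumes "distributed M lborel X (exponential_density l)" and "0 < l"
  shows "AE \<omega> in M. 0 \<le> X \<omega>"
proof -
  have [measurable]: "random_variable borel X"
    using distributed_measurable[OF assms(1)] by simp
  have "\<P>(\<omega> in M. 0 < X \<omega>) = 1"
    using exponential_distributedD_gt[OF assms(1) order_refl assms(2)] by simp
  then have "AE \<omega> in M. \<omega> \<in> {\<omega>\<in>space M. 0 < X \<omega>}"
    by (intro prob_eq_1[THEN iffD1]) auto
  then show ?thesis
    by eventually_elim auto
qed

section \<open>Independence within one update cycle\<close>

context parallel_cache_cycle
begin

lemma timer_measurable [measurable]:
  "random_variable borel T"
  "k \<in> {1..K} \<Longrightarrow> random_variable borel (W k)"
  "k \<in> {1..K} \<Longrightarrow> random_variable borel (V k)"
  using distributed_measurable[OF source_exponential] distributed_measurable[OF to_cache_exponential]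
    distributed_measurable[OF to_user_exponential] by simp_all

text \<open>Joint independence is restricted to two disjoint singleton blocks of timers, and
  evaluation at the single index recovers each variable.\<close>

lemma indep_to_cache_to_user:
  assumes k: "k \<in> {1..K}"
  shows "indep_var borel (W k) borel (V k)"
proof -
  let ?X = "\<lambda>i. case i of Source \<Rightarrow> T | To_Cache k \<Rightarrow> W k | To_User k \<Rightarrow> V k"
  have "indep_var borel ((\<lambda>f. f (To_Cache k)) \<circ> (\<lambda>\<omega>. \<lambda>i\<in>{To_Cache k}. ?X i \<omega>))
      borel ((\<lambda>f. f (To_User k)) \<circ> (\<lambda>\<omega>. \<lambda>i\<in>{To_User k}. ?X i \<omega>))"
    using k by (intro indep_var_compose[OF indep_var_restrict[OF timers_independent]]) auto
  then show ?thesis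
    by (simp add: comp_def)
qed

text \<open>Index \<open>0\<close> is the end of the cycle, so that the waiting time is the minimum over \<open>{0..K}\<close>.\<close>

definition delay :: "nat \<Rightarrow> 'a \<Rightarrow> real" where
  "delay k \<omega> = (if k = 0 then T \<omega> else W k \<omega> + V k \<omega>)"

text \<open>The delays are measurable functions of pairwise disjoint blocks of independent timers:
  \<open>G k\<close> is the block of indices used by delay \<open>k\<close>, and \<open>Y k\<close>
  the function applied to it.\<close>

lemma indep_delay: "indep_vars (\<lambda>_. borel) delay {0..K}"
proof -
  let ?X = "\<lambda>i. case i of Source \<Rightarrow> T | To_Cache k \<Rightarrow> W k | To_User k \<Rightarrow> V k"
  define G where "G k = (if k = 0 then {Source} else {To_Cache k, To_User k})" for k
  define Y where "Y k f = (if k = 0 then f Source else f (To_Cache k) + f (To_User k) :: real)" for k f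
  have "indep_vars (\<lambda>k. PiM (G k) (\<lambda>_. borel)) (\<lambda>k \<omega>. \<lambda>i\<in>G k. ?X i \<omega>) {0..K}"
    by (rule indep_vars_restrict[OF timers_independent])
       (auto simp: G_def disjoint_family_on_def split: if_splits)
  then have "indep_vars (\<lambda>_. borel) (\<lambda>k \<omega>. Y k (\<lambda>i\<in>G k. ?X i \<omega>)) {0..K}"
  proof (rule indep_vars_compose2)
    fix k
    show "Y k \<in> borel_measurable (PiM (G k) (\<lambda>_. borel))"
      by (cases "k = 0")
        (auto simp: Y_def[abs_def] G_def intro!: borel_measurable_add measurable_component_singleton)
  qed
  then show ?thesis
    by (subst indep_vars_cong[OF refl _ refl]) (auto simp: Y_def G_def delay_def)
qed

lemma user_wait_eq_Min_delay: "user_wait K T W V \<omega> = Min ((\<lambda>k. delay k \<omega>) ` {0..K})"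
proof -
  have "(\<lambda>k. delay k \<omega>) ` {0..K} = insert (T \<omega>) ((\<lambda>k. W k \<omega> + V k \<omega>) ` {1..K})"
    by (subst atLeastAtMost_insertL[symmetric]) (auto simp: delay_def)
  then show ?thesis
    by (simp add: user_wait_def)
qed

lemma measurable_user_wait [measurable]: "random_variable borel (user_wait K T W V)"
proof -
  have "random_variable borel (delay k)" if "k \<in> {0..K}" for k
    using indep_delay that by (auto simp: indep_vars_def)
  then have "random_variable borel (\<lambda>\<omega>. Min ((\<lambda>k. delay k \<omega>) ` {0..K}))"
    by (intro borel_measurable_Min) auto
  then show ?thesis
    by (simp add: user_wait_eq_Min_delay[abs_def])
qed

text \<open>A finite minimum exceeds \<open>t\<close> exactly when every delay does, so the event is
  an intersection of independent events. Index 0 is then split off as the source factor.\<close>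

lemma prob_user_wait_gt:
  "\<P>(\<omega> in M. t < user_wait K T W V \<omega>) =
    \<P>(\<omega> in M. t < T \<omega>) * (\<Prod>k=1..K. \<P>(\<omega> in M. t < W k \<omega> + V k \<omega>))"
proof -
  have "\<P>(\<omega> in M. t < user_wait K T W V \<omega>) = prob (\<Inter>k\<in>{0..K}. delay k -` {t<..} \<inter> space M)"
    by (rule arg_cong[where f = prob]) (auto simp: user_wait_eq_Min_delay)
  also have "\<dots> = (\<Prod>k\<in>{0..K}. prob (delay k -` {t<..} \<inter> space M))"
    by (rule indep_varsD[OF indep_delay]) auto
  also have "{0..K} = insert 0 {1..K}"
    by auto
  also have "(\<Prod>k\<in>insert 0 {1..K}. prob (delay k -` {t<..} \<inter> space M)) =
      prob (delay 0 -` {t<..} \<inter> space M) * (\<Prod>k=1..K. prob (delay k -` {t<..} \<inter> space M))"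
    by simp
  also have "prob (delay 0 -` {t<..} \<inter> space M) = \<P>(\<omega> in M. t < T \<omega>)"
    by (rule arg_cong[where f = prob]) (auto simp: delay_def)
  also have "(\<Prod>k=1..K. prob (delay k -` {t<..} \<inter> space M)) =
      (\<Prod>k=1..K. \<P>(\<omega> in M. t < W k \<omega> + V k \<omega>))"
    by (intro prod.cong arg_cong[where f = prob]) (auto simp: delay_def)
  finally show ?thesis .
qed

end

section \<open>Expansion over rate choices and integration of signed exponential sums\<close>

text \<open>Each factor is a sum over the two-element set \<open>{c k, u k}\<close>; distributivity
  turns the product of these sums into a sum over choice functions.\<close>

lemma prod_exponential_tails_eq_sum:
  fixes c u :: "nat \<Rightarrow> real"
  assumes "\<And>k. k \<in> {1..K} \<Longrightarrow> c k \<noteq> 0" "\<And>k. k \<in> {1..K} \<Longrightarrow> u k \<noteq> 0"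
    and ne: "\<And>k. k \<in> {1..K} \<Longrightarrow> c k \<noteq> u k"
  shows "(\<Prod>k=1..K. (c k * exp (- u k * t) - u k * exp (- c k * t)) / (c k - u k)) =
    ((\<Prod>k=1..K. c k) * (\<Prod>k=1..K. u k)) / (\<Prod>k=1..K. c k - u k) *
      (\<Sum>p\<in>rate_choices K c u.
         (- 1) ^ num_cache_rates K c p / (\<Prod>k=1..K. p k) * exp (- (\<Sum>k=1..K. p k) * t))"
proof -
  \<comment> \<open>The sign is read off by testing \<open>x = c k\<close>. As
    \<open>c k \<noteq> u k\<close>, the test separates the two choices and neither summand is lost
    from the set \<open>{c k, u k}\<close>.\<close>
  let ?g = "\<lambda>k x. (if x = c k then - 1 else 1) / x * exp (- x * t)"
  have "(\<Prod>k=1..K. (c k * exp (- u k * t) - u k * exp (- c k * t)) / (c k - u k)) =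
      (\<Prod>k=1..K. c k * u k / (c k - u k) * (\<Sum>x\<in>{c k, u k}. ?g k x))"
  proof (rule prod.cong)
    fix k assume "k \<in> {1..K}"
    with assms[of k] have "c k \<noteq> 0" "u k \<noteq> 0" "c k \<noteq> u k"
      by auto
    then show "(c k * exp (- u k * t) - u k * exp (- c k * t)) / (c k - u k) =
        c k * u k / (c k - u k) * (\<Sum>x\<in>{c k, u k}. ?g k x)"
      by (simp add: field_simps)
  qed simp
  also have "\<dots> = ((\<Prod>k=1..K. c k) * (\<Prod>k=1..K. u k)) / (\<Prod>k=1..K. c k - u k) *
      (\<Sum>p\<in>rate_choices K c u. \<Prod>k=1..K. ?g k (p k))"
    unfolding rate_choices_def
    by (subst prod_sum_PiE[symmetric]) (simp_all add: prod.distrib prod_dividef)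
  also have "(\<Sum>p\<in>rate_choices K c u. \<Prod>k=1..K. ?g k (p k)) = (\<Sum>p\<in>rate_choices K c u.
         (- 1) ^ num_cache_rates K c p / (\<Prod>k=1..K. p k) * exp (- (\<Sum>k=1..K. p k) * t))"
  proof (rule sum.cong)
    fix p
    have "(\<Prod>k=1..K. if p k = c k then - 1 else 1 :: real) = (- 1) ^ num_cache_rates K c p"
      by (simp add: num_cache_rates_def prod.If_cases Int_def)
    moreover have "exp (- (\<Sum>k=1..K. p k) * t) = (\<Prod>k=1..K. exp (- p k * t))"
      by (subst exp_sum[symmetric]) (auto simp: sum_distrib_right sum_negf)
    ultimately show "(\<Prod>k=1..K. ?g k (p k)) =
        (- 1) ^ num_cache_rates K c p / (\<Prod>k=1..K. p k) * exp (- (\<Sum>k=1..K. p k) * t)"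
      by (simp add: prod.distrib prod_dividef)
  qed simp
  finally show ?thesis .
qed

text \<open>The coefficients \<open>A p\<close> may be negative, so the nonnegative integral cannot
  be split over \<open>p\<close>. The whole sum, which is nonnegative, is integrated at once through
  its antiderivative.\<close>

lemma nn_integral_exp_sum:
  fixes A r :: "'i \<Rightarrow> real"
  assumes "finite P" and pos: "\<And>p. p \<in> P \<Longrightarrow> 0 < r p"
    and nonneg: "\<And>t. 0 \<le> t \<Longrightarrow> 0 \<le> (\<Sum>p\<in>P. A p * exp (- r p * t))"
  shows "(\<integral>\<^sup>+t. ennreal (\<Sum>p\<in>P. A p * exp (- r p * t)) * indicator {0..} t \<partial>lborel) =
    ennreal (\<Sum>p\<in>P. A p / r p)"
    and "0 \<le> (\<Sum>p\<in>P. A p / r p)"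
proof -
  let ?F = "\<lambda>t. \<Sum>p\<in>P. - (A p / r p) * exp (- r p * t)"
  have "(?F \<longlongrightarrow> (\<Sum>p\<in>P. - (A p / r p) * 0)) at_top"
    using pos by (intro tendsto_intros tendsto_exp_neg_mult_at_top)
  then have lim: "(?F \<longlongrightarrow> 0) at_top"
    by simp
  have deriv: "(?F has_real_derivative (\<Sum>p\<in>P. A p * exp (- r p * t))) (at t)" for t
  proof (rule DERIV_sum)
    fix p assume "p \<in> P"
    with pos[of p] show "((\<lambda>t. - (A p / r p) * exp (- r p * t)) has_real_derivative
        A p * exp (- r p * t)) (at t)"
      by (auto intro!: derivative_eq_intros)
  qed
  have "(\<integral>\<^sup>+t. ennreal (\<Sum>p\<in>P. A p * exp (- r p * t)) * indicator {0..} t \<partial>lborel) =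
      ennreal (0 - ?F 0)"
    by (rule nn_integral_FTC_atLeast[OF _ deriv nonneg lim]) auto
  then show "(\<integral>\<^sup>+t. ennreal (\<Sum>p\<in>P. A p * exp (- r p * t)) * indicator {0..} t \<partial>lborel) =
    ennreal (\<Sum>p\<in>P. A p / r p)"
    by (simp add: sum_negf)
  \<comment> \<open>\<open>?F\<close> is nondecreasing on the half-line and tends to 0, hence
    \<open>?F 0 \<le> 0\<close>; the claimed value is minus \<open>?F 0\<close>.\<close>
  have "?F 0 \<le> ?F t" if "0 \<le> t" for t
    using that nonneg deriv by (intro DERIV_nonneg_imp_nondecreasing[of 0 t ?F]) blast+
  then have "?F 0 \<le> 0"
    by (intro tendsto_lowerbound[OF lim]) (auto intro: eventually_at_top_linorderI[of 0])
  then show "0 \<le> (\<Sum>p\<in>P. A p / r p)"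
    by (simp add: sum_negf)
qed

section \<open>Expected waiting time and freshness\<close>

theorem mainTheorem1:
  fixes M :: "'a measure"
    and K :: nat
    and lam :: real
    and c u :: "nat \<Rightarrow> real"
    and T :: "'a \<Rightarrow> real"
    and W V :: "nat \<Rightarrow> 'a \<Rightarrow> real"
  assumes "K \<ge> 1"
    and "lam > 0"
    and "\<And>k. k \<in> {1..K} \<Longrightarrow> c k > 0"
    and "\<And>k. k \<in> {1..K} \<Longrightarrow> u k > 0"
    and "\<And>k. k \<in> {1..K} \<Longrightarrow> c k \<noteq> u k"
    and "parallel_cache_cycle M K lam c u T W V"
  shows "user_freshness M K T W V =
    1 - ((\<Prod>k=1..K. c k) * (\<Prod>k=1..K. u k)) / (\<Prod>k=1..K. c k - u k) *
      (\<Sum>p\<in>rate_choices K c u.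
         (- 1) ^ num_cache_rates K c p / (\<Prod>k=1..K. p k) *
         (1 / (1 + (\<Sum>k=1..K. p k) / lam)))"
proof -
  interpret parallel_cache_cycle M K lam c u T W V by fact
  note lam = \<open>lam > 0\<close> and c = assms(3) and u = assms(4) and ne = assms(5)
  let ?U = "user_wait K T W V"
  define B where "B = ((\<Prod>k=1..K. c k) * (\<Prod>k=1..K. u k)) / (\<Prod>k=1..K. c k - u k)"
  define A where "A p = (- 1) ^ num_cache_rates K c p / (\<Prod>k=1..K. p k)" for p
  \<comment> \<open>The decay rate of a term after multiplication by the source tail
    \<open>exp (- lam * t)\<close>.\<close>
  define r where "r p = lam + (\<Sum>k=1..K. p k)" for p
  have fin: "finite (rate_choices K c u)"
    unfolding rate_choices_def by (intro finite_PiE) auto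
  have rates_nonneg: "0 \<le> (\<Sum>k=1..K. p k)" if "p \<in> rate_choices K c u" for p
  proof (rule sum_nonneg)
    fix k assume k: "k \<in> {1..K}"
    with that have "p k \<in> {c k, u k}"
      unfolding rate_choices_def by (rule PiE_mem)
    with c[OF k] u[OF k] show "0 \<le> p k"
      by auto
  qed
  have tail: "\<P>(\<omega> in M. t < ?U \<omega>) = (\<Sum>p\<in>rate_choices K c u. B * A p * exp (- r p * t))"
    if t: "0 \<le> t" for t
  proof -
    have "(\<Prod>k=1..K. \<P>(\<omega> in M. t < W k \<omega> + V k \<omega>)) =
        (\<Prod>k=1..K. (c k * exp (- u k * t) - u k * exp (- c k * t)) / (c k - u k))"
      using t c u ne
      by (intro prod.cong prob_exponential_sum_gt to_cache_exponential to_user_exponential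
          indep_to_cache_to_user) auto
    also have "\<dots> = B * (\<Sum>p\<in>rate_choices K c u. A p * exp (- (\<Sum>k=1..K. p k) * t))"
      unfolding A_def B_def
      by (rule prod_exponential_tails_eq_sum) (use c u ne in force)+
    finally show ?thesis
      unfolding prob_user_wait_gt exponential_distributedD_gt[OF source_exponential t lam]
      by (auto simp: sum_distrib_left r_def mult_exp_exp algebra_simps intro!: sum.cong)
  qed
  have r_pos: "0 < r p" if "p \<in> rate_choices K c u" for p
    using lam rates_nonneg[OF that] by (simp add: r_def)
  \<comment> \<open>The signs of the terms alternate with the choice, so nonnegativity comes from
    the sum being a probability.\<close>
  have tail_nonneg: "0 \<le> (\<Sum>p\<in>rate_choices K c u. B * A p * exp (- r p * t))" if "0 \<le> t" for t
    unfolding tail[OF that, symmetric] by (rule measure_nonneg)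
  \<comment> \<open>The exponential laws give nonnegativity only almost surely; finitely many
    exceptional null sets are combined.\<close>
  have U_nonneg: "AE \<omega> in M. 0 \<le> ?U \<omega>"
  proof -
    have "AE \<omega> in M. 0 \<le> W k \<omega> \<and> 0 \<le> V k \<omega>" if "k \<in> {1..K}" for k
      using AE_exponential_nonneg[OF to_cache_exponential c, of k]
        AE_exponential_nonneg[OF to_user_exponential u, of k] that
      by simp
    then have "AE \<omega> in M. \<forall>k\<in>{1..K}. 0 \<le> W k \<omega> \<and> 0 \<le> V k \<omega>"
      by (intro AE_finite_allI) auto
    moreover have "AE \<omega> in M. 0 \<le> T \<omega>"
      by (rule AE_exponential_nonneg[OF source_exponential lam])
    ultimately show ?thesis
      by eventually_elim (auto simp: user_wait_def)
  qed
  have ET: "expectation T = 1 / lam"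
    by (rule exponential_distributed_expectation[OF lam source_exponential])
  \<comment> \<open>A non-integrable function has Bochner integral 0, whereas this expectation is
    \<open>1 / lam \<noteq> 0\<close>.\<close>
  with lam have int_T: "integrable M T"
    using not_integrable_integral_eq[of M T] by auto
  have int_U: "integrable M ?U"
  \<comment> \<open>Almost surely the waiting time lies between 0 and \<open>T\<close>, because
    \<open>T\<close> belongs to the minimum.\<close>
  proof (rule Bochner_Integration.integrable_bound[OF int_T])
    show "AE \<omega> in M. norm (?U \<omega>) \<le> norm (T \<omega>)"
      using U_nonneg by eventually_elim (auto simp: user_wait_def)
  qed measurable
  have "(\<integral>\<^sup>+\<omega>. ennreal (?U \<omega>) \<partial>M) =
      (\<integral>\<^sup>+t. ennreal (\<Sum>p\<in>rate_choices K c u. B * A p * exp (- r p * t)) * indicator {0..} t \<partial>lborel)"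
    unfolding nn_integral_eq_nn_integral_tail[OF measurable_user_wait]
    by (intro nn_integral_cong) (auto simp: tail split: split_indicator)
  also have "\<dots> = ennreal (\<Sum>p\<in>rate_choices K c u. B * A p / r p)"
    by (rule nn_integral_exp_sum[OF fin r_pos tail_nonneg])
  finally have "ennreal (expectation ?U) = ennreal (\<Sum>p\<in>rate_choices K c u. B * A p / r p)"
    by (simp add: nn_integral_eq_integral[OF int_U U_nonneg])
  moreover have "0 \<le> (\<Sum>p\<in>rate_choices K c u. B * A p / r p)"
    by (rule nn_integral_exp_sum[OF fin r_pos tail_nonneg])
  ultimately have EU: "expectation ?U = (\<Sum>p\<in>rate_choices K c u. B * A p / r p)"
    using integral_nonneg_AE[OF U_nonneg] by simp
  have "user_freshness M K T W V = (expectation T - expectation ?U) / expectation T"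
    using int_T int_U by (simp add: user_freshness_def fresh_duration_def[abs_def])
  \<comment> \<open>Dividing by \<open>expectation T = 1 / lam\<close> puts the factor
    \<open>lam\<close> into each term; \<open>lam / r p\<close> then becomes the stated fraction on
    dividing through by \<open>lam\<close>.\<close>
  also have "\<dots> = 1 - B * (\<Sum>p\<in>rate_choices K c u. A p * (lam / r p))"
    using lam by (simp add: ET EU field_simps sum_distrib_left)
  also have "(\<Sum>p\<in>rate_choices K c u. A p * (lam / r p)) =
      (\<Sum>p\<in>rate_choices K c u. A p * (1 / (1 + (\<Sum>k=1..K. p k) / lam)))"
    using lam by (intro sum.cong) (auto simp: r_def field_simps)
  finally show ?thesis
    unfolding A_def B_def .
qed

end
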